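(* Let $0<p\le1$ be a constant and $0<\varepsilon<(p/4)^{16}$. There is a constant $n_0$ such that for every natural number $n\ge n_0$, every graph $G\in\mathcal{Q}(n^{(2)},p,\varepsilon)$ admits a $10\varepsilon$-near quadrangular embedding.
   Context: Cut distance: for edge-weighted graphs $G,H$ on the same vertex set $V$, $\mathsf{d}_\square(G,H)=\max_{U,W\subseteq V}|\mathsf{e}_G(U,W)-\mathsf{e}_H(U,W)|/|V|^2$, with $\mathsf{e}_G(U,W)$ the total weight of edges with one endvertex in $U$ and the other in $W$. $K(n^{(2)},p)$ is the weighted complete bipartite graph on $V_1\sqcup V_2$, $|V_1|=|V_2|=n$, all edges between $V_1$ and $V_2$ having weight $p$. $\mathcal{Q}(n^{(2)},p,\varepsilon)$ is the set of graphs $G$ on vertex set $V_1\sqcup V_2$ (after a suitable identification) with $\mathsf{d}_\square(G,K(n^{(2)},p))<\varepsilon$. An embedding is a 2-cell embedding in an orientable surface (rotation system). For $\delta>0$ an embedding is $\delta$-near quadrangular if all but at most $2\delta|E(G)|$ edges of $G$ belong to two quadrangular faces (faces bounded by cycles of length 4). *)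

theory Defs
  imports Complex_Main "Graph_Theory.Pair_Digraph" "HOL-Combinatorics.Orbits"
begin

text \<open>
  Finite simple graphs are the symmetric loop-free digraphs of \<^locale>\<open>pair_graph\<close>; an edge
  is the set of its two ends, and the two arcs on it are its two orientations.
\<close>

definition uedges :: "'a pair_pre_digraph \<Rightarrow> 'a set set" where
  "uedges G = {{u, v} | u v. (u, v) \<in> parcs G}"

text \<open>
  An edge-weighted graph on a vertex set is a weight function on unordered pairs of distinct
  vertices, non-edges having weight 0. In \<open>cut_weight\<close> each edge is counted once, also if it
  lies inside \<open>U \<inter> W\<close>.
\<close>

definition cut_weight :: "('a set \<Rightarrow> real) \<Rightarrow> 'a set \<Rightarrow> 'a set \<Rightarrow> real" where
  "cut_weight w U W = (\<Sum>e \<in> {{u, v} | u v. u \<in> U \<and> v \<in> W \<and> u \<noteq> v}. w e)"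

definition cut_dist :: "'a set \<Rightarrow> ('a set \<Rightarrow> real) \<Rightarrow> ('a set \<Rightarrow> real) \<Rightarrow> real" where
  "cut_dist V w w' =
     Max {\<bar>cut_weight w U W - cut_weight w' U W\<bar> | U W. U \<subseteq> V \<and> W \<subseteq> V} / (real (card V))\<^sup>2"

definition graph_weight :: "'a pair_pre_digraph \<Rightarrow> 'a set \<Rightarrow> real" where
  "graph_weight G e = (if e \<in> uedges G then 1 else 0)"

definition complete_bipartite_weight :: "'a set \<Rightarrow> 'a set \<Rightarrow> real \<Rightarrow> 'a set \<Rightarrow> real" where
  "complete_bipartite_weight V1 V2 p e = (if \<exists>u\<in>V1. \<exists>v\<in>V2. e = {u, v} then p else 0)"

text \<open>The identification of the vertex set with that of the complete bipartite graph is the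
  choice of \<open>V1\<close> and \<open>V2\<close>. The graph itself need not be bipartite.\<close>

definition quasirandom_bipartite :: "nat \<Rightarrow> real \<Rightarrow> real \<Rightarrow> 'a pair_pre_digraph set" where
  "quasirandom_bipartite n p \<epsilon> =
     {G. pair_graph G \<and>
         (\<exists>V1 V2. V1 \<inter> V2 = {} \<and> V1 \<union> V2 = pverts G \<and> card V1 = n \<and> card V2 = n \<and>
            cut_dist (pverts G) (graph_weight G) (complete_bipartite_weight V1 V2 p) < \<epsilon>)}"

definition neighbours :: "'a pair_pre_digraph \<Rightarrow> 'a \<Rightarrow> 'a set" where
  "neighbours G v = {u. (v, u) \<in> parcs G}"

text \<open>
  A 2-cell embedding in an orientable surface is given by its rotation system: \<open>rot v\<close> is a
  cyclic permutation of the neighbours of \<open>v\<close>. If the graph is disconnected, this describes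
  a 2-cell embedding of each component in its own surface. Values of \<open>rot v\<close> outside
  the neighbours of \<open>v\<close> are irrelevant.
\<close>

definition rotation_system :: "'a pair_pre_digraph \<Rightarrow> ('a \<Rightarrow> 'a \<Rightarrow> 'a) \<Rightarrow> bool" where
  "rotation_system G rot \<longleftrightarrow>
     (\<forall>v \<in> pverts G. neighbours G v \<noteq> {} \<longrightarrow> cyclic_on (rot v) (neighbours G v))"

text \<open>Face tracing: a face is the set of arcs on its boundary walk, so each arc lies on exactly
  one face and each edge is traversed twice in total.\<close>

definition face_succ :: "('a \<Rightarrow> 'a \<Rightarrow> 'a) \<Rightarrow> 'a \<times> 'a \<Rightarrow> 'a \<times> 'a" where
  "face_succ rot a = (snd a, rot (snd a) (fst a))"

definition faces :: "'a pair_pre_digraph \<Rightarrow> ('a \<Rightarrow> 'a \<Rightarrow> 'a) \<Rightarrow> ('a \<times> 'a) set set" where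
  "faces G rot = orbit (face_succ rot) ` parcs G"

text \<open>Distinctness of the vertices excludes closed walks of length 4 that are not cycles.\<close>

definition quadrangular :: "('a \<times> 'a) set \<Rightarrow> bool" where
  "quadrangular F \<longleftrightarrow>
     (\<exists>a b c d. distinct [a, b, c, d] \<and> F = {(a, b), (b, c), (c, d), (d, a)})"

definition on_face :: "'a set \<Rightarrow> ('a \<times> 'a) set \<Rightarrow> bool" where
  "on_face e F \<longleftrightarrow> (\<exists>u v. (u, v) \<in> F \<and> e = {u, v})"

definition near_quadrangular :: "real \<Rightarrow> 'a pair_pre_digraph \<Rightarrow> ('a \<Rightarrow> 'a \<Rightarrow> 'a) \<Rightarrow> bool" where
  "near_quadrangular \<delta> G rot \<longleftrightarrow>
     real (card {e \<in> uedges G. card {F \<in> faces G rot. quadrangular F \<and> on_face e F} \<noteq> 2})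
       \<le> 2 * \<delta> * real (card (uedges G))"

end

theory Submission
  imports Defs "HOL-Combinatorics.Cycles"
begin

text \<open>
  Only the edge density of \<open>G\<close> matters. By the Kovari-Sos-Turan argument a dense graph contains
  a copy of \<open>K\<^sub>t\<^sub>,\<^sub>t\<close> for a large even constant \<open>t\<close>, so copies can be removed greedily until few
  edges are left. Each copy has a quadrangular embedding. Putting it back into an embedding of the
  rest means merging two cyclic rotations at each of its \<open>2t\<close> vertices; merging changes two
  corners and so spoils at most two quadrangles, which costs \<open>16t\<close> of the \<open>2t\<^sup>2\<close> arcs of the copy.
\<close>

section \<open>Cyclic permutations\<close>

lemma cycle_of_list_nth:
  assumes "distinct cs" and "i < length cs"
  shows "cycle_of_list cs (cs ! i) = cs ! (Suc i mod length cs)"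
proof -
  have "map (cycle_of_list cs) cs = rotate1 cs"
    using cyclic_rotation[OF assms(1), of 1] by simp
  then have "map (cycle_of_list cs) cs ! i = rotate1 cs ! i"
    by (rule arg_cong)
  then show ?thesis
    using assms(2) by (simp add: nth_rotate1)
qed

lemma cyclic_on_cycle_of_list:
  assumes "distinct cs" and "cs \<noteq> []"
  shows "cyclic_on (cycle_of_list cs) (set cs)"
proof (rule cyclic_on_singleI)
  have funpow_nth: "(cycle_of_list cs ^^ n) (cs ! 0) = cs ! (n mod length cs)" for n
    by (induction n) (use assms in \<open>simp_all add: cycle_of_list_nth mod_Suc_eq\<close>)
  show "cs ! 0 \<in> set cs"
    using assms(2) by simp
  have "orbit (cycle_of_list cs) (cs ! 0) = {(cycle_of_list cs ^^ i) (cs ! 0) | i. i < length cs}"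
    using assms(2) by (intro orbit_altdef_bounded) (simp_all add: funpow_nth)
  also have "\<dots> = {cs ! i | i. i < length cs}"
    by (intro Collect_cong) (metis funpow_nth mod_less)
  also have "\<dots> = set cs"
    by (rule set_conv_nth[symmetric])
  finally show "set cs = orbit (cycle_of_list cs) (cs ! 0)" ..
qed

lemma ex_cyclic_on:
  assumes "finite S" and "S \<noteq> {}"
  shows "\<exists>f. cyclic_on f S"
  using finite_distinct_list[OF assms(1)] assms(2) cyclic_on_cycle_of_list by fastforce

lemma ex_alternating_cyclic_on:
  assumes "finite S" and "S \<noteq> {}" and "even (card S)"
  shows "\<exists>f P. f permutes S \<and> cyclic_on f S \<and> P \<subseteq> S \<and> (\<forall>x\<in>S. f x \<in> P \<longleftrightarrow> x \<notin> P)"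
proof -
  obtain cs where cs: "set cs = S" "distinct cs"
    using finite_distinct_list[OF assms(1)] by blast
  then have "even (length cs)"
    using assms(3) distinct_card by metis
  define P where "P = {cs ! i | i. i < length cs \<and> even i}"
  have nth_mem_P: "cs ! i \<in> P \<longleftrightarrow> even i" if "i < length cs" for i
    using that cs(2) by (auto simp: P_def nth_eq_iff_index_eq)
  have "cycle_of_list cs x \<in> P \<longleftrightarrow> x \<notin> P" if "x \<in> S" for x
  proof -
    have "x \<in> set cs"
      using that cs(1) by simp
    then obtain i where i: "i < length cs" "x = cs ! i"
      by (auto simp: in_set_conv_nth)
    have "cycle_of_list cs x \<in> P \<longleftrightarrow> even (Suc i mod length cs)"
      unfolding i(2) cycle_of_list_nth[OF cs(2) i(1)]
      using i(1) by (intro nth_mem_P mod_less_divisor) auto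
    also have "\<dots> \<longleftrightarrow> odd i"
      using \<open>even (length cs)\<close> by (simp only: dvd_mod_iff even_Suc)
    also have "\<dots> \<longleftrightarrow> x \<notin> P"
      using nth_mem_P[OF i(1)] i(2) by simp
    finally show ?thesis .
  qed
  moreover have "P \<subseteq> S"
    using cs(1) by (auto simp: P_def)
  moreover have "cyclic_on (cycle_of_list cs) S"
    using cyclic_on_cycle_of_list[OF cs(2)] cs(1) assms(2) by auto
  moreover have "cycle_of_list cs permutes S"
    using cycle_permutes[of cs] cs(1) by simp
  ultimately show ?thesis
    by (intro exI[of _ "cycle_of_list cs"] exI[of _ P]) simp
qed

lemma cyclic_on_inv:
  assumes "permutation f" and "cyclic_on f S"
  shows "cyclic_on (inv f) S"
  using assms by (simp add: cyclic_on_def orbit_inv_eq)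

lemma orbit_subset_orbit_comp_transpose:
  assumes "y \<notin> orbit f x"
  shows "orbit f x \<subseteq> orbit (f \<circ> transpose x y) y"
proof
  let ?h = "f \<circ> transpose x y"
  fix z assume "z \<in> orbit f x"
  then show "z \<in> orbit ?h y"
  proof induction
    case base
    show ?case
      by (rule orbit_eqI(1)) simp
  next
    case (step z)
    have "z \<noteq> y"
      using step.hyps assms by blast
    show ?case
    proof (cases "z = x")
      case True
      then show ?thesis
        by (intro orbit_eqI(1)) simp
    next
      case False
      then show ?thesis
        using \<open>z \<noteq> y\<close> by (intro orbit_eqI(2)[OF _ step.IH]) simp
    qed
  qed
qed

lemma cyclic_on_comp_transpose:
  assumes f: "cyclic_on f S" "cyclic_on f T" and disj: "S \<inter> T = {}" and xy: "x \<in> S" "y \<in> T"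
  shows "cyclic_on (f \<circ> transpose x y) (S \<union> T)"
proof (rule cyclic_on_singleI)
  let ?h = "f \<circ> transpose x y"
  have orbits: "orbit f x = S" "orbit f y = T"
    by (rule orbit_cyclic_eq3[OF f(1) xy(1)], rule orbit_cyclic_eq3[OF f(2) xy(2)])
  have S: "S \<subseteq> orbit ?h y"
    using orbit_subset_orbit_comp_transpose[of y f x] orbits disj xy by auto
  have "T \<subseteq> orbit ?h x"
    using orbit_subset_orbit_comp_transpose[of x f y] orbits disj xy
    by (auto simp: transpose_commute)
  then have T: "T \<subseteq> orbit ?h y"
    using S xy(1) by (blast intro: orbit_trans)
  have closed: "?h z \<in> S \<union> T" if "z \<in> S \<union> T" for z
    using that xy cyclic_on_inI[OF f(1)] cyclic_on_inI[OF f(2)] by (auto simp: transpose_def)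
  have "z \<in> S \<union> T" if "z \<in> orbit ?h y" for z
    using that by induction (rule closed, simp add: xy)+
  then show "S \<union> T = orbit ?h y"
    using S T by blast
  show "y \<in> S \<union> T"
    using xy by simp
qed

section \<open>Rotations and quadrangular arcs\<close>

definition rotation_on :: "('a \<times> 'a) set \<Rightarrow> ('a \<Rightarrow> 'a \<Rightarrow> 'a) \<Rightarrow> bool" where
  "rotation_on E rot \<longleftrightarrow> (\<forall>v. E `` {v} \<noteq> {} \<longrightarrow> cyclic_on (rot v) (E `` {v}))"

text \<open>The first conjunct only matters when \<open>rot\<close> is not a rotation system: then the orbit of an
  arc need not contain the arc.\<close>

definition quadrangular_arc :: "('a \<Rightarrow> 'a \<Rightarrow> 'a) \<Rightarrow> 'a \<times> 'a \<Rightarrow> bool" where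
  "quadrangular_arc rot e \<longleftrightarrow>
     e \<in> orbit (face_succ rot) e \<and> quadrangular (orbit (face_succ rot) e)"

definition nonquadrangular_arcs ::
    "('a \<times> 'a) set \<Rightarrow> ('a \<Rightarrow> 'a \<Rightarrow> 'a) \<Rightarrow> ('a \<times> 'a) set" where
  "nonquadrangular_arcs E rot = {e \<in> E. \<not> quadrangular_arc rot e}"

lemma quadrangularD:
  assumes "quadrangular F"
  shows "finite F" and "card F = 4"
  using assms by (auto simp: quadrangular_def)

lemma quadrangular_rev_notin:
  assumes "quadrangular F" and "(u, v) \<in> F"
  shows "(v, u) \<notin> F"
  using assms by (auto simp: quadrangular_def)

lemma quadrangular_arcI:
  assumes "distinct [a, b, c, d]" and "rot b a = c" "rot c b = d" "rot d c = a" "rot a d = b"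
  shows "quadrangular_arc rot (a, b)"
proof -
  let ?s = "face_succ rot"
  have funpows: "(?s ^^ 4) (a, b) = (a, b)" "(?s ^^ 3) (a, b) = (d, a)" "(?s ^^ 2) (a, b) = (c, d)"
      "?s (a, b) = (b, c)"
    using assms(2-) by (simp_all add: eval_nat_numeral face_succ_def)
  have "orbit ?s (a, b) = {(?s ^^ i) (a, b) | i. i < 4}"
    by (rule orbit_altdef_bounded) (simp_all add: funpows)
  also have "\<dots> = (\<lambda>i. (?s ^^ i) (a, b)) ` {..<4}"
    by auto
  also have "{..<4} = {0, 1, 2, 3 :: nat}"
    by auto
  also have "(\<lambda>i. (?s ^^ i) (a, b)) ` \<dots> = {(a, b), (b, c), (c, d), (d, a)}"
    by (simp add: funpows)
  finally show ?thesis
    unfolding quadrangular_arc_def quadrangular_def using assms(1) by auto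
qed

lemma quadrangular_arc_orbit:
  assumes "quadrangular_arc rot e" and "x \<in> orbit (face_succ rot) e"
  shows "orbit (face_succ rot) x = orbit (face_succ rot) e" and "quadrangular_arc rot x"
proof -
  have e: "e \<in> orbit (face_succ rot) e"
    using assms(1) by (simp add: quadrangular_arc_def)
  then have "e \<in> orbit (face_succ rot) x"
    using assms(2) by (rule orbit_swap)
  then show "orbit (face_succ rot) x = orbit (face_succ rot) e"
    using assms(2) by (blast intro: orbit_trans)
  then show "quadrangular_arc rot x"
    using assms by (simp add: quadrangular_arc_def)
qed

lemma quadrangular_arc_cong:
  assumes "quadrangular_arc rot e"
    and "\<And>u v. (u, v) \<in> orbit (face_succ rot) e \<Longrightarrow> rot' v u = rot v u"
  shows "quadrangular_arc rot' e"
proof -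
  have "orbit (face_succ rot') e = orbit (face_succ rot) e"
    using assms by (intro orbit_cong) (auto simp: quadrangular_arc_def face_succ_def)
  then show ?thesis
    using assms(1) by (simp add: quadrangular_arc_def)
qed

lemma orbit_face_succ_subset:
  assumes "rotation_on E rot" and "sym E" and "e \<in> E"
  shows "orbit (face_succ rot) e \<subseteq> E"
proof
  have closed: "face_succ rot a \<in> E" if "a \<in> E" for a
  proof -
    obtain u v where a: "a = (u, v)"
      by (cases a)
    then have u: "u \<in> E `` {v}"
      using that assms(2) by (auto dest: symD)
    then have "cyclic_on (rot v) (E `` {v})"
      using assms(1) by (auto simp: rotation_on_def)
    then show ?thesis
      using cyclic_on_inI[OF _ u] by (simp add: a face_succ_def)
  qed
  fix x assume "x \<in> orbit (face_succ rot) e"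
  then show "x \<in> E"
    by induction (use closed assms(3) in auto)
qed

lemma ex_rotation_on:
  assumes "finite E"
  shows "\<exists>rot. rotation_on E rot"
proof -
  have "\<exists>f. E `` {v} \<noteq> {} \<longrightarrow> cyclic_on f (E `` {v})" for v
    using ex_cyclic_on[of "E `` {v}"] finite_Image[OF assms] by blast
  then show ?thesis
    unfolding rotation_on_def by metis
qed

section \<open>Merging rotations\<close>

lemma card_nonquadrangular_arcs_perturb:
  assumes "finite E" and "finite X" and eq: "\<And>u v. (u, v) \<notin> X \<Longrightarrow> rot' v u = rot v u"
  shows "card (nonquadrangular_arcs E rot') \<le> card (nonquadrangular_arcs E rot) + 4 * card X"
proof -
  define Q where "Q = {x \<in> X. quadrangular_arc rot x}"
  let ?faces = "\<Union>x\<in>Q. orbit (face_succ rot) x"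
  have orbit_Q: "finite (orbit (face_succ rot) x)" "card (orbit (face_succ rot) x) = 4"
    if "x \<in> Q" for x
    using that by (auto simp: Q_def quadrangular_arc_def dest: quadrangularD)
  have "e \<in> ?faces" if "\<not> quadrangular_arc rot' e" and e: "quadrangular_arc rot e" for e
  proof -
    have "\<not> orbit (face_succ rot) e \<subseteq> - X"
      using quadrangular_arc_cong[OF e, of rot'] eq that(1) by blast
    then obtain x where x: "x \<in> orbit (face_succ rot) e" "x \<in> X"
      by blast
    then have "x \<in> Q" "e \<in> orbit (face_succ rot) x"
      using quadrangular_arc_orbit[OF e x(1)] e by (auto simp: Q_def quadrangular_arc_def)
    then show ?thesis
      by blast
  qed
  then have "nonquadrangular_arcs E rot' \<subseteq> nonquadrangular_arcs E rot \<union> ?faces"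
    by (auto simp: nonquadrangular_arcs_def)
  moreover have "finite Q"
    using assms(2) by (simp add: Q_def)
  ultimately have "card (nonquadrangular_arcs E rot')
      \<le> card (nonquadrangular_arcs E rot \<union> ?faces)"
    using assms(1) orbit_Q(1) by (intro card_mono) (auto simp: nonquadrangular_arcs_def)
  also have "\<dots> \<le> card (nonquadrangular_arcs E rot) + card ?faces"
    by (rule card_Un_le)
  also have "card ?faces \<le> (\<Sum>x\<in>Q. 4)"
    using card_UN_le[OF \<open>finite Q\<close>, of "orbit (face_succ rot)"] orbit_Q(2) by simp
  also have "\<dots> \<le> 4 * card X"
    using assms(2) by (simp add: Q_def card_mono)
  finally show ?thesis
    by simp
qed

lemma ex_common_rotation:
  assumes rot1: "rotation_on E\<^sub>1 rot\<^sub>1" "sym E\<^sub>1" and rot2: "rotation_on E\<^sub>2 rot\<^sub>2" "sym E\<^sub>2"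
    and disj: "E\<^sub>1 \<inter> E\<^sub>2 = {}"
  shows "\<exists>rot. rotation_on E\<^sub>1 rot \<and> rotation_on E\<^sub>2 rot \<and>
    nonquadrangular_arcs (E\<^sub>1 \<union> E\<^sub>2) rot
      \<subseteq> nonquadrangular_arcs E\<^sub>1 rot\<^sub>1 \<union> nonquadrangular_arcs E\<^sub>2 rot\<^sub>2"
proof -
  define rot where "rot v u = (if (v, u) \<in> E\<^sub>1 then rot\<^sub>1 v u else rot\<^sub>2 v u)" for v u
  have eq1: "rot v u = rot\<^sub>1 v u" if "(v, u) \<in> E\<^sub>1" for u v
    using that by (simp add: rot_def)
  have eq2: "rot v u = rot\<^sub>2 v u" if "(v, u) \<in> E\<^sub>2" for u v
    using that disj by (auto simp: rot_def)
  have "quadrangular_arc rot e" if "e \<in> E\<^sub>1" "quadrangular_arc rot\<^sub>1 e" for e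
    using orbit_face_succ_subset[OF rot1 that(1)] symD[OF rot1(2)] eq1
    by (intro quadrangular_arc_cong[OF that(2)]) blast
  moreover have "quadrangular_arc rot e" if "e \<in> E\<^sub>2" "quadrangular_arc rot\<^sub>2 e" for e
    using orbit_face_succ_subset[OF rot2 that(1)] symD[OF rot2(2)] eq2
    by (intro quadrangular_arc_cong[OF that(2)]) blast
  moreover have "cyclic_on (rot v) (E\<^sub>1 `` {v}) = cyclic_on (rot\<^sub>1 v) (E\<^sub>1 `` {v})"
      "cyclic_on (rot v) (E\<^sub>2 `` {v}) = cyclic_on (rot\<^sub>2 v) (E\<^sub>2 `` {v})" for v
    by (auto intro!: cyclic_cong eq1 eq2)
  ultimately show ?thesis
    using rot1(1) rot2(1)
    by (intro exI[of _ rot]) (auto simp: rotation_on_def nonquadrangular_arcs_def)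
qed

lemma ex_merged_rotation:
  assumes rot: "rotation_on E\<^sub>1 rot" "rotation_on E\<^sub>2 rot"
    and disj: "E\<^sub>1 \<inter> E\<^sub>2 = {}" and fin: "finite E\<^sub>1" "finite E\<^sub>2"
  shows "\<exists>rot'. rotation_on (E\<^sub>1 \<union> E\<^sub>2) rot' \<and>
    card (nonquadrangular_arcs (E\<^sub>1 \<union> E\<^sub>2) rot')
      \<le> card (nonquadrangular_arcs (E\<^sub>1 \<union> E\<^sub>2) rot) + 8 * card (Domain E\<^sub>1 \<inter> Domain E\<^sub>2)"
proof -
  define M where "M = Domain E\<^sub>1 \<inter> Domain E\<^sub>2"
  have "finite M"
    using fin by (simp add: M_def finite_Domain)
  have "\<forall>v\<in>M. \<exists>x y. (v, x) \<in> E\<^sub>1 \<and> (v, y) \<in> E\<^sub>2"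
    by (auto simp: M_def)
  then obtain x y where xy: "\<And>v. v \<in> M \<Longrightarrow> (v, x v) \<in> E\<^sub>1" "\<And>v. v \<in> M \<Longrightarrow> (v, y v) \<in> E\<^sub>2"
    by metis
  define rot' where "rot' v = (if v \<in> M then rot v \<circ> transpose (x v) (y v) else rot v)" for v
  have "cyclic_on (rot' v) ((E\<^sub>1 \<union> E\<^sub>2) `` {v})" if "(E\<^sub>1 \<union> E\<^sub>2) `` {v} \<noteq> {}" for v
  proof (cases "v \<in> M")
    case True
    have "cyclic_on (rot v \<circ> transpose (x v) (y v)) (E\<^sub>1 `` {v} \<union> E\<^sub>2 `` {v})"
      using xy[OF True] rot disj by (intro cyclic_on_comp_transpose) (auto simp: rotation_on_def)
    then show ?thesis
      using True by (simp add: rot'_def Un_Image)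
  next
    case False
    then have "E\<^sub>1 `` {v} = {} \<or> E\<^sub>2 `` {v} = {}"
      by (auto simp: M_def)
    then show ?thesis
      using that rot False by (auto simp: rot'_def Un_Image rotation_on_def)
  qed
  then have rotation: "rotation_on (E\<^sub>1 \<union> E\<^sub>2) rot'"
    by (simp add: rotation_on_def)
  let ?X = "(\<lambda>v. (x v, v)) ` M \<union> (\<lambda>v. (y v, v)) ` M"
  have "card ?X \<le> card M + card M"
    by (intro card_Un_le[THEN order_trans] add_mono card_image_le \<open>finite M\<close>)
  moreover have "card (nonquadrangular_arcs (E\<^sub>1 \<union> E\<^sub>2) rot')
      \<le> card (nonquadrangular_arcs (E\<^sub>1 \<union> E\<^sub>2) rot) + 4 * card ?X"
    using fin \<open>finite M\<close>
    by (intro card_nonquadrangular_arcs_perturb) (auto simp: rot'_def transpose_def)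
  ultimately show ?thesis
    using rotation unfolding M_def by (intro exI[of _ rot'] conjI) linarith+
qed

section \<open>Complete bipartite graphs\<close>

definition complete_bipartite_arcs :: "'a set \<Rightarrow> 'a set \<Rightarrow> ('a \<times> 'a) set" where
  "complete_bipartite_arcs A B = A \<times> B \<union> B \<times> A"

definition alternating_rotation :: "('a \<Rightarrow> 'a) \<Rightarrow> 'a set \<Rightarrow> 'a \<Rightarrow> 'a \<Rightarrow> 'a" where
  "alternating_rotation \<sigma> P v = (if v \<in> P then \<sigma> else inv \<sigma>)"

lemma sym_complete_bipartite_arcs: "sym (complete_bipartite_arcs A B)"
  by (auto simp: complete_bipartite_arcs_def sym_def)

lemma complete_bipartite_arcs_subset:
  assumes "sym E" and "A \<times> B \<subseteq> E"
  shows "complete_bipartite_arcs A B \<subseteq> E"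
  using assms by (auto simp: complete_bipartite_arcs_def dest: symD)

lemma disjoint_if_Times_subset:
  assumes "irrefl E" and "A \<times> B \<subseteq> E"
  shows "A \<inter> B = {}"
  using assms by (auto simp: irrefl_def)

lemma card_complete_bipartite_arcs:
  assumes "finite A" and "finite B" and "A \<inter> B = {}"
  shows "card (complete_bipartite_arcs A B) = 2 * card A * card B"
proof -
  have "card (A \<times> B \<union> B \<times> A) = card (A \<times> B) + card (B \<times> A)"
    using assms by (intro card_Un_disjoint) auto
  then show ?thesis
    by (simp add: complete_bipartite_arcs_def card_cartesian_product)
qed

lemma card_eq_card_Diff_complete_bipartite_arcs:
  assumes "finite E" and "sym E" and "irrefl E" and "A \<times> B \<subseteq> E" and "finite A" and "finite B"
  shows "card E = card (E - complete_bipartite_arcs A B) + 2 * card A * card B"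
proof -
  have K: "complete_bipartite_arcs A B \<subseteq> E"
    using assms(2,4) by (rule complete_bipartite_arcs_subset)
  then have "card (complete_bipartite_arcs A B) \<le> card E"
    using assms(1) by (intro card_mono)
  then show ?thesis
    using card_Diff_subset[OF finite_subset[OF K assms(1)] K]
      card_complete_bipartite_arcs[OF assms(5,6) disjoint_if_Times_subset[OF assms(3,4)]]
    by simp
qed

text \<open>The face through \<open>(a, b)\<close> visits \<open>a\<close>, \<open>b\<close>, \<open>c\<close>, \<open>d\<close>, where \<open>c\<close> is a neighbour of \<open>a\<close> on the
  cycle \<open>A\<close> and \<open>d\<close> a neighbour of \<open>b\<close> on the cycle \<open>B\<close>. As the colours (membership in \<open>P\<close>)
  of \<open>c\<close> and \<open>d\<close> are opposite to those of \<open>a\<close> and \<open>b\<close>, the next two steps undo the first two.\<close>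

lemma quadrangular_arc_alternating_rotation:
  assumes \<sigma>: "permutation \<sigma>" "cyclic_on \<sigma> A" "cyclic_on \<sigma> B"
    and alternating: "\<And>x. x \<in> A \<union> B \<Longrightarrow> \<sigma> x \<in> P \<longleftrightarrow> x \<notin> P"
    and ab: "a \<in> A" "b \<in> B" "A \<inter> B = {}"
  shows "quadrangular_arc (alternating_rotation \<sigma> P) (a, b)"
proof -
  let ?rot = "alternating_rotation \<sigma> P"
  have bij: "bij \<sigma>"
    using \<sigma>(1) by (rule permutation_bijective)
  have closed: "?rot v u \<in> C" if "u \<in> C" "cyclic_on \<sigma> C" for u v C
    using that cyclic_on_inv[OF \<sigma>(1)]
    by (auto simp: alternating_rotation_def intro: cyclic_on_inI)
  have flip: "?rot v u \<in> P \<longleftrightarrow> u \<notin> P" if "u \<in> A \<union> B" for u v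
  proof -
    have "inv \<sigma> u \<in> A \<union> B"
      using that cyclic_on_inv[OF \<sigma>(1)] \<sigma>(2,3) by (blast intro: cyclic_on_inI)
    then show ?thesis
      using alternating[OF that] alternating[of "inv \<sigma> u"] bij
      by (auto simp: alternating_rotation_def bij_is_surj surj_f_inv_f)
  qed
  have undo: "?rot w (?rot v u) = u" if "w \<in> P \<longleftrightarrow> v \<notin> P" for u v w
    using that bij by (auto simp: alternating_rotation_def bij_is_inj bij_is_surj surj_f_inv_f)
  define c d where "c = ?rot b a" and "d = ?rot c b"
  have c: "c \<in> A" "c \<in> P \<longleftrightarrow> a \<notin> P" and d: "d \<in> B" "d \<in> P \<longleftrightarrow> b \<notin> P"
    using ab closed \<sigma>(2,3) flip by (auto simp: c_def d_def)
  show ?thesis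
  proof (rule quadrangular_arcI)
    show "distinct [a, b, c, d]"
      using c d ab by auto
    show "?rot d c = a" "?rot a d = b"
      using undo[of d b a] undo[of a c b] c(2) d(2) by (simp_all add: c_def d_def)
  qed (simp_all add: c_def d_def)
qed

lemma ex_alternating_permutation:
  assumes A: "finite A" "A \<noteq> {}" "even (card A)" and B: "finite B" "B \<noteq> {}" "even (card B)"
    and disj: "A \<inter> B = {}"
  shows "\<exists>\<sigma> P. permutation \<sigma> \<and> cyclic_on \<sigma> A \<and> cyclic_on \<sigma> B \<and>
    (\<forall>x\<in>A \<union> B. \<sigma> x \<in> P \<longleftrightarrow> x \<notin> P)"
proof -
  obtain f P where f: "f permutes A" "cyclic_on f A" "P \<subseteq> A" "\<forall>x\<in>A. f x \<in> P \<longleftrightarrow> x \<notin> P"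
    using ex_alternating_cyclic_on[OF A] by blast
  obtain g Q where g: "g permutes B" "cyclic_on g B" "Q \<subseteq> B" "\<forall>x\<in>B. g x \<in> Q \<longleftrightarrow> x \<notin> Q"
    using ex_alternating_cyclic_on[OF B] by blast
  have on_A: "(f \<circ> g) x = f x" "f x \<in> A" if "x \<in> A" for x
    using that permutes_not_in[OF g(1)] permutes_in_image[OF f(1)] disj
    by (simp_all add: disjoint_iff)
  have on_B: "(f \<circ> g) x = g x" "g x \<in> B" if "x \<in> B" for x
    using that permutes_not_in[OF f(1), of "g x"] permutes_in_image[OF g(1)] disj by auto
  have "(f \<circ> g) x \<in> P \<union> Q \<longleftrightarrow> x \<notin> P \<union> Q" if "x \<in> A \<union> B" for x
    using that
  proof
    assume "x \<in> A"
    then show ?thesis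
      using on_A f(3,4) g(3) disj by fastforce
  next
    assume "x \<in> B"
    then show ?thesis
      using on_B g(3,4) f(3) disj by fastforce
  qed
  moreover have "permutation (f \<circ> g)" "cyclic_on (f \<circ> g) A" "cyclic_on (f \<circ> g) B"
    using f(1,2) g(1,2) A(1) B(1) disj
    by (auto intro: permutation_compose permutes_imp_permutation
        permutes_comp_preserves_cyclic1 permutes_comp_preserves_cyclic2)
  ultimately show ?thesis
    by (intro exI[of _ "f \<circ> g"] exI[of _ "P \<union> Q"]) blast
qed

lemma ex_quadrangular_rotation_complete_bipartite:
  assumes A: "finite A" "A \<noteq> {}" "even (card A)" and B: "finite B" "B \<noteq> {}" "even (card B)"
    and disj: "A \<inter> B = {}"
  shows "\<exists>rot. rotation_on (complete_bipartite_arcs A B) rot \<and>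
    nonquadrangular_arcs (complete_bipartite_arcs A B) rot = {}"
proof -
  obtain \<sigma> P where \<sigma>: "permutation \<sigma>" "cyclic_on \<sigma> A" "cyclic_on \<sigma> B"
    and alternating: "\<forall>x\<in>A \<union> B. \<sigma> x \<in> P \<longleftrightarrow> x \<notin> P"
    using ex_alternating_permutation[OF A B disj] by blast
  let ?K = "complete_bipartite_arcs A B" and ?rot = "alternating_rotation \<sigma> P"
  have "quadrangular_arc ?rot (a, b)" "quadrangular_arc ?rot (b, a)" if "a \<in> A" "b \<in> B" for a b
    using that disj alternating
    by (auto intro: quadrangular_arc_alternating_rotation[OF \<sigma>]
        quadrangular_arc_alternating_rotation[OF \<sigma>(1,3,2)])
  then have "nonquadrangular_arcs ?K ?rot = {}"
    by (auto simp: nonquadrangular_arcs_def complete_bipartite_arcs_def)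
  moreover have "?K `` {v} = (if v \<in> A then B else if v \<in> B then A else {})" for v
    using disj by (auto simp: complete_bipartite_arcs_def)
  then have "rotation_on ?K ?rot"
    using \<sigma> cyclic_on_inv by (auto simp: rotation_on_def alternating_rotation_def)
  ultimately show ?thesis
    by blast
qed

lemma ex_rotation_on_extend_complete_bipartite:
  assumes E: "finite E" "sym E" "irrefl E" and AB: "A \<times> B \<subseteq> E"
    and A: "finite A" "A \<noteq> {}" "even (card A)" and B: "finite B" "B \<noteq> {}" "even (card B)"
    and rot: "rotation_on (E - complete_bipartite_arcs A B) rot"
  shows "\<exists>rot'. rotation_on E rot' \<and> card (nonquadrangular_arcs E rot')
    \<le> card (nonquadrangular_arcs (E - complete_bipartite_arcs A B) rot) + 8 * (card A + card B)"
proof -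
  let ?K = "complete_bipartite_arcs A B"
  let ?R = "E - ?K"
  have K: "?K \<subseteq> E" "finite ?K" "?R \<union> ?K = E" "?R \<inter> ?K = {}"
    using complete_bipartite_arcs_subset[OF E(2) AB] finite_subset[OF _ E(1)] by auto
  have R: "finite ?R" "sym ?R"
    using E(1,2) sym_complete_bipartite_arcs[of A B] by (auto simp: sym_def)
  obtain rotK where rotK: "rotation_on ?K rotK" "nonquadrangular_arcs ?K rotK = {}"
    using ex_quadrangular_rotation_complete_bipartite[OF A B disjoint_if_Times_subset[OF E(3) AB]]
    by blast
  obtain r where r: "rotation_on ?R r" "rotation_on ?K r"
      "nonquadrangular_arcs E r \<subseteq> nonquadrangular_arcs ?R rot"
    using ex_common_rotation[OF rot R(2) rotK(1) sym_complete_bipartite_arcs K(4)] rotK(2)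
    unfolding K(3) by auto
  obtain rot' where rot': "rotation_on E rot'" "card (nonquadrangular_arcs E rot')
      \<le> card (nonquadrangular_arcs E r) + 8 * card (Domain ?R \<inter> Domain ?K)"
    using ex_merged_rotation[OF r(1,2) K(4) R(1) K(2)] unfolding K(3) by blast
  note rot'(2)
  also have "card (nonquadrangular_arcs E r) \<le> card (nonquadrangular_arcs ?R rot)"
    using r(3) E(1) by (intro card_mono) (auto simp: nonquadrangular_arcs_def)
  also have "card (Domain ?R \<inter> Domain ?K) \<le> card (A \<union> B)"
    using A(1) B(1) by (intro card_mono) (auto simp: complete_bipartite_arcs_def)
  also have "card (A \<union> B) \<le> card A + card B"
    by (rule card_Un_le)
  finally show ?thesis
    using rot'(1) by auto
qed

section \<open>Complete bipartite subgraphs of dense graphs\<close>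

lemma card_eq_sum_Image:
  assumes "finite X" and "finite Y" and "E \<subseteq> X \<times> Y"
  shows "card E = (\<Sum>x\<in>X. card (E `` {x}))"
proof -
  have "E = Sigma X (\<lambda>x. E `` {x})"
    using assms(3) by auto
  moreover have "finite (E `` {x})" for x
    using assms finite_subset[of "E `` {x}" Y] by auto
  ultimately show ?thesis
    using assms(1) card_SigmaI by metis
qed

lemma card_le_card_high_degree:
  fixes d :: real
  assumes "finite X" and "finite Y" and "E \<subseteq> X \<times> Y" and "0 \<le> d"
  shows "card E \<le> real (card {x \<in> X. d \<le> card (E `` {x})}) * card Y + card X * d"
proof -
  define H where "H = {x \<in> X. d \<le> card (E `` {x})}"
  have "H \<subseteq> X"
    by (auto simp: H_def)
  have "real (card E) = (\<Sum>x\<in>X. real (card (E `` {x})))"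
    using card_eq_sum_Image[OF assms(1-3)] by simp
  also have "\<dots> \<le> (\<Sum>x\<in>X. (if x \<in> H then real (card Y) else 0) + d)"
  proof (rule sum_mono)
    fix x assume "x \<in> X"
    have "card (E `` {x}) \<le> card Y"
      using assms(2,3) by (intro card_mono) auto
    then show "real (card (E `` {x})) \<le> (if x \<in> H then real (card Y) else 0) + d"
      using \<open>x \<in> X\<close> assms(4) by (auto simp: H_def)
  qed
  also have "\<dots> = real (card H) * card Y + card X * d"
    using assms(1) \<open>H \<subseteq> X\<close> by (simp add: sum.distrib sum.If_cases Int_absorb1)
  finally show ?thesis
    by (simp add: H_def)
qed

lemma ex_common_subset_of_many:
  assumes "finite S" and "finite W" and "W \<noteq> {}"
    and F: "\<And>w. w \<in> W \<Longrightarrow> F w \<subseteq> S \<and> s \<le> card (F w)"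
    and W: "t * (card S choose s) \<le> card W"
  shows "\<exists>A B. card A = s \<and> B \<subseteq> W \<and> card B = t \<and> (\<forall>w\<in>B. A \<subseteq> F w)"
proof -
  define \<A> where "\<A> = {A. A \<subseteq> S \<and> card A = s}"
  have \<A>: "finite \<A>" "card \<A> = card S choose s"
    using assms(1) by (simp_all add: \<A>_def n_subsets)
  have "\<exists>A. A \<subseteq> F w \<and> card A = s" if "w \<in> W" for w
    using F[OF that] obtain_subset_with_card_n by metis
  then obtain g where g: "\<And>w. w \<in> W \<Longrightarrow> g w \<subseteq> F w \<and> card (g w) = s"
    by metis
  then have "g \<in> W \<rightarrow> \<A>"
    using F by (auto simp: \<A>_def) blast
  moreover from this have "\<A> \<noteq> {}"
    using assms(3) by auto
  ultimately obtain A where A: "A \<in> \<A>" "card W \<le> card (g -` {A} \<inter> W) * card \<A>"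
    using pigeonhole_card assms(2) \<A>(1) by metis
  have "card \<A> > 0"
    using A(1) \<A>(1) card_gt_0_iff by blast
  then have "t \<le> card (g -` {A} \<inter> W)"
    using W A(2) \<A>(2) by (metis mult_le_cancel2 order_trans)
  then obtain B where "B \<subseteq> g -` {A} \<inter> W" "card B = t"
    by (meson obtain_subset_with_card_n)
  then show ?thesis
    using A(1) g by (intro exI[of _ A] exI[of _ B]) (auto simp: \<A>_def)
qed

text \<open>Kovari-Sos-Turan, with the convexity argument replaced by a restriction to boundedly many
  vertices of high degree: many vertices of \<open>Y\<close> have \<open>s\<close> neighbours among these, and there are
  boundedly many choices for the \<open>s\<close> neighbours.\<close>

lemma ex_complete_bipartite_if_min_degree:
  fixes d :: real
  assumes S: "finite S" "S \<noteq> {}" and Y: "finite Y" "Y \<noteq> {}" and E: "E \<subseteq> S \<times> Y"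
    and degree: "\<And>x. x \<in> S \<Longrightarrow> d * card Y \<le> card (E `` {x})" and "0 < d"
    and large: "real (2 * s) \<le> d * card S" "real (2 * t * (card S choose s)) \<le> d * card Y"
  shows "\<exists>A B. card A = s \<and> card B = t \<and> A \<times> B \<subseteq> E"
proof -
  have converse: "E\<inverse> \<subseteq> Y \<times> S"
    using E by auto
  define W where "W = {y \<in> Y. s \<le> card (E\<inverse> `` {y})}"
  have "card S * (d * card Y) \<le> (\<Sum>x\<in>S. real (card (E `` {x})))"
    using degree by (intro sum_bounded_below)
  also have "\<dots> = card (E\<inverse>)"
    using card_eq_sum_Image[OF S(1) Y(1) E] by simp
  also have "\<dots> \<le> real (card W) * card S + real (card Y) * s"
    using card_le_card_high_degree[OF Y(1) S(1) converse, of s] by (simp add: W_def)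
  also have "real (card Y) * s \<le> card Y * (d / 2 * card S)"
    using large(1) by (intro mult_left_mono) auto
  finally have "(d / 2 * card Y) * card S \<le> real (card W) * card S"
    by (simp add: algebra_simps)
  then have W: "d / 2 * card Y \<le> card W"
    using S by (simp add: card_gt_0_iff)
  then have "real (t * (card S choose s)) \<le> card W"
    using large(2) by simp
  then have "t * (card S choose s) \<le> card W"
    by (simp only: of_nat_le_iff)
  moreover have "0 < d / 2 * card Y"
    using \<open>0 < d\<close> Y by (simp add: card_gt_0_iff)
  then have "W \<noteq> {}"
    using W by auto
  moreover have "finite W" "\<And>w. w \<in> W \<Longrightarrow> E\<inverse> `` {w} \<subseteq> S \<and> s \<le> card (E\<inverse> `` {w})"
    using Y(1) E by (auto simp: W_def)
  ultimately obtain A B where AB: "card A = s" "card B = t" "\<forall>w\<in>B. A \<subseteq> E\<inverse> `` {w}"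
    using ex_common_subset_of_many[OF S(1), of W "\<lambda>w. E\<inverse> `` {w}"] by metis
  then have "A \<times> B \<subseteq> E"
    by auto
  with AB show ?thesis
    by blast
qed

lemma ex_complete_bipartite_if_dense:
  fixes c :: real
  assumes fin: "finite X" "finite Y" "Y \<noteq> {}" and E: "E \<subseteq> X \<times> Y" "c * card X * card Y \<le> card E"
    and c: "0 < c" "0 < K" "real (4 * s) \<le> c * K"
    and large: "real (2 * K) \<le> c * card X" "real (4 * t * (K choose s)) \<le> c * card Y"
  shows "\<exists>A B. card A = s \<and> card B = t \<and> A \<times> B \<subseteq> E"
proof -
  have "card Y > 0"
    using fin by auto
  define H where "H = {x \<in> X. c / 2 * card Y \<le> card (E `` {x})}"
  have "(c / 2 * card X) * card Y \<le> real (card H) * card Y"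
    using card_le_card_high_degree[OF fin(1,2) E(1), of "c / 2 * card Y"] E(2) c(1)
    by (simp add: H_def algebra_simps)
  then have "K \<le> card H"
    using \<open>card Y > 0\<close> large(1) by simp
  then obtain S where S: "S \<subseteq> H" "card S = K" "finite S"
    by (meson obtain_subset_with_card_n)
  have "(E \<inter> S \<times> Y) `` {x} = E `` {x}" if "x \<in> S" for x
    using that E(1) by auto
  then have "c / 2 * card Y \<le> card ((E \<inter> S \<times> Y) `` {x})" if "x \<in> S" for x
    using that S(1) by (auto simp: H_def)
  moreover have "S \<noteq> {}"
    using S(2) c(2) by auto
  ultimately have "\<exists>A B. card A = s \<and> card B = t \<and> A \<times> B \<subseteq> E \<inter> S \<times> Y"
    using S(2,3) fin c large by (intro ex_complete_bipartite_if_min_degree[where d = "c / 2"]) auto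
  then show ?thesis
    by blast
qed

lemma kovari_sos_turan_dense:
  fixes c :: real
  assumes "0 < c"
  shows "\<exists>N. \<forall>(X :: 'a set) (Y :: 'b set) E. finite X \<longrightarrow> finite Y \<longrightarrow> N \<le> card X \<longrightarrow> N \<le> card Y \<longrightarrow>
    E \<subseteq> X \<times> Y \<longrightarrow> c * card X * card Y \<le> card E \<longrightarrow>
    (\<exists>A B. card A = s \<and> card B = t \<and> A \<times> B \<subseteq> E)"
proof -
  obtain K :: nat where K: "real (4 * s) < K * c"
    using reals_Archimedean3[OF assms] by blast
  then have "0 < K"
    by (cases K) auto
  have K_large: "real (4 * s) \<le> c * K"
    using K by (simp add: mult.commute)
  define L where "L = 2 * K + 4 * t * (K choose s)"
  obtain N :: nat where N: "real L < N * c"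
    using reals_Archimedean3[OF assms] by blast
  then have "0 < N"
    by (cases N) auto
  have scaled: "m \<le> c * n" if "m \<le> L" "N \<le> n" for m n :: nat
  proof -
    have "real m \<le> L"
      using that(1) by simp
    also have "\<dots> \<le> N * c"
      using N by simp
    also have "\<dots> \<le> c * n"
      using that(2) assms by (simp add: mult.commute)
    finally show ?thesis .
  qed
  show ?thesis
  proof (intro exI[of _ N] allI impI)
    fix X :: "'a set" and Y :: "'b set" and E
    assume XY: "finite X" "finite Y" "N \<le> card X" "N \<le> card Y"
      and E: "E \<subseteq> X \<times> Y" "c * card X * card Y \<le> card E"
    have "Y \<noteq> {}"
      using XY(4) \<open>0 < N\<close> by auto
    then show "\<exists>A B. card A = s \<and> card B = t \<and> A \<times> B \<subseteq> E"
      using XY(3,4)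
      by (intro ex_complete_bipartite_if_dense[OF XY(1,2) _ E assms \<open>0 < K\<close> K_large] scaled)
        (simp_all add: L_def)
  qed
qed

section \<open>Nearly quadrangular embeddings of dense graphs\<close>

lemma ex_rotation_on_greedy:
  fixes m :: real
  assumes "finite E" and "sym E" and "irrefl E" and t: "even t" "0 < t"
    and "\<And>E'. E' \<subseteq> E \<Longrightarrow> m \<le> card E' \<Longrightarrow> \<exists>A B. card A = t \<and> card B = t \<and> A \<times> B \<subseteq> E'"
  shows "\<exists>rot. rotation_on E rot \<and> card (nonquadrangular_arcs E rot) \<le> m + 8 / t * card E"
  using assms(1-3,6)
proof (induction E rule: finite_psubset_induct)
  case (psubset E)
  show ?case
  proof (cases "m \<le> card E")
    case False
    obtain rot where "rotation_on E rot"
      using ex_rotation_on[OF psubset.hyps(1)] by blast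
    moreover have "card (nonquadrangular_arcs E rot) \<le> card E"
      using psubset.hyps(1) by (intro card_mono) (auto simp: nonquadrangular_arcs_def)
    then have "card (nonquadrangular_arcs E rot) \<le> m + 8 / t * card E"
      using False by (intro add_increasing2) auto
    ultimately show ?thesis
      by blast
  next
    case True
    then obtain A B where AB: "card A = t" "card B = t" "A \<times> B \<subseteq> E"
      using psubset.prems(3) by blast
    let ?R = "E - complete_bipartite_arcs A B"
    have A: "finite A" "A \<noteq> {}" "even (card A)" and B: "finite B" "B \<noteq> {}" "even (card B)"
      using AB(1,2) t by (auto intro: card_ge_0_finite)
    have card_E: "card E = card ?R + 2 * t * t"
      using card_eq_card_Diff_complete_bipartite_arcs[OF psubset.hyps(1) psubset.prems(1,2) AB(3)]
        A(1) B(1) AB(1,2) by simp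
    have R: "sym ?R" "irrefl ?R" "?R \<subset> E"
      using psubset.prems(1,2) sym_complete_bipartite_arcs[of A B] card_E t(2)
      by (auto simp: sym_def irrefl_def)
    obtain r where r: "rotation_on ?R r" "card (nonquadrangular_arcs ?R r) \<le> m + 8 / t * card ?R"
      using psubset.IH[OF R(3,1,2)] psubset.prems(3) by (meson Diff_subset order_trans)
    obtain rot where rot: "rotation_on E rot"
        "card (nonquadrangular_arcs E rot) \<le> card (nonquadrangular_arcs ?R r) + 8 * (t + t)"
      using ex_rotation_on_extend_complete_bipartite[OF psubset.hyps(1) psubset.prems(1,2) AB(3) A B
          r(1)] unfolding AB(1,2) by blast
    have "8 / t * card ?R + 8 * (t + t) = 8 / t * card E"
      using t(2) card_E by (simp add: field_simps)
    then have "card (nonquadrangular_arcs E rot) \<le> m + 8 / t * card E"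
      using rot(2) r(2) by linarith
    then show ?thesis
      using rot(1) by blast
  qed
qed

lemma ex_rotation_on_dense:
  fixes \<gamma> \<eta> :: real
  assumes "0 < \<gamma>" and "0 < \<eta>"
  shows "\<exists>N. \<forall>(V :: 'a set) E. finite V \<longrightarrow> N \<le> card V \<longrightarrow> E \<subseteq> V \<times> V \<longrightarrow> sym E \<longrightarrow> irrefl E \<longrightarrow>
    (\<exists>rot. rotation_on E rot \<and>
      card (nonquadrangular_arcs E rot) \<le> \<gamma> * (card V)\<^sup>2 + \<eta> * card E)"
proof -
  obtain k :: nat where k: "8 / \<eta> \<le> k"
    using real_arch_simple by blast
  define t where "t = 2 * Suc k"
  have t: "even t" "0 < t" "8 / t \<le> \<eta>"
    using k assms(2) by (auto simp: t_def field_simps)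
  obtain N where N: "\<And>(X :: 'a set) (Y :: 'a set) E. finite X \<Longrightarrow> finite Y \<Longrightarrow> N \<le> card X \<Longrightarrow>
      N \<le> card Y \<Longrightarrow> E \<subseteq> X \<times> Y \<Longrightarrow> \<gamma> * card X * card Y \<le> card E \<Longrightarrow>
      \<exists>A B. card A = t \<and> card B = t \<and> A \<times> B \<subseteq> E"
    using kovari_sos_turan_dense[OF assms(1), of t t] by metis
  show ?thesis
  proof (intro exI[of _ N] allI impI)
    fix V :: "'a set" and E
    assume V: "finite V" "N \<le> card V" and E: "E \<subseteq> V \<times> V" "sym E" "irrefl E"
    have "finite E"
      using E(1) V(1) by (meson finite_SigmaI finite_subset)
    moreover have "\<exists>A B. card A = t \<and> card B = t \<and> A \<times> B \<subseteq> E'"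
      if "E' \<subseteq> E" "\<gamma> * (card V)\<^sup>2 \<le> card E'" for E'
      using that E(1) N[OF V(1,1,2,2), of E'] by (simp add: power2_eq_square mult.assoc)
    ultimately obtain rot where rot: "rotation_on E rot"
        "card (nonquadrangular_arcs E rot) \<le> \<gamma> * (card V)\<^sup>2 + 8 / t * card E"
      using ex_rotation_on_greedy[OF _ E(2,3) t(1,2)] by blast
    moreover have "8 / t * card E \<le> \<eta> * card E"
      using t(3) by (intro mult_right_mono) auto
    ultimately show "\<exists>rot. rotation_on E rot \<and>
        card (nonquadrangular_arcs E rot) \<le> \<gamma> * (card V)\<^sup>2 + \<eta> * card E"
      by (intro exI[of _ rot]) linarith
  qed
qed

lemma quadrangular_face_eq_orbit:
  assumes "F \<in> faces G rot" and "quadrangular F" and "e \<in> F" and "quadrangular_arc rot e"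
  shows "F = orbit (face_succ rot) e"
proof -
  have "orbit (face_succ rot) e \<subseteq> F"
    using assms(1,3) by (auto simp: faces_def intro: orbit_trans)
  then show ?thesis
    using assms(2,4) quadrangularD by (metis card_subset_eq quadrangular_arc_def)
qed

lemma card_quadrangular_faces_on_edge:
  assumes arcs: "(u, v) \<in> parcs G" "(v, u) \<in> parcs G"
    and quad: "quadrangular_arc rot (u, v)" "quadrangular_arc rot (v, u)"
  shows "card {F \<in> faces G rot. quadrangular F \<and> on_face {u, v} F} = 2"
proof -
  let ?face = "orbit (face_succ rot)"
  have "{F \<in> faces G rot. quadrangular F \<and> on_face {u, v} F} = {?face (u, v), ?face (v, u)}"
  proof (intro equalityI subsetI)
    fix F assume "F \<in> {F \<in> faces G rot. quadrangular F \<and> on_face {u, v} F}"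
    then have F: "F \<in> faces G rot" "quadrangular F" "(u, v) \<in> F \<or> (v, u) \<in> F"
      by (auto simp: on_face_def doubleton_eq_iff)
    then have "F = ?face (u, v) \<or> F = ?face (v, u)"
      using quadrangular_face_eq_orbit[OF F(1,2)] quad by metis
    then show "F \<in> {?face (u, v), ?face (v, u)}"
      by simp
  next
    fix F assume "F \<in> {?face (u, v), ?face (v, u)}"
    then show "F \<in> {F \<in> faces G rot. quadrangular F \<and> on_face {u, v} F}"
      using quad arcs by (auto simp: faces_def on_face_def quadrangular_arc_def)
  qed
  moreover have "?face (u, v) \<noteq> ?face (v, u)"
  proof
    assume "?face (u, v) = ?face (v, u)"
    then have "(u, v) \<in> ?face (u, v)" "(v, u) \<in> ?face (u, v)" "quadrangular (?face (u, v))"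
      using quad by (auto simp: quadrangular_arc_def)
    then show False
      using quadrangular_rev_notin by metis
  qed
  ultimately show ?thesis
    by simp
qed

lemma near_quadrangularI:
  fixes \<delta> :: real
  assumes "finite (parcs G)" and "sym (parcs G)"
    and "card (nonquadrangular_arcs (parcs G) rot) \<le> 2 * \<delta> * card (uedges G)"
  shows "near_quadrangular \<delta> G rot"
proof -
  let ?bad = "{e \<in> uedges G. card {F \<in> faces G rot. quadrangular F \<and> on_face e F} \<noteq> 2}"
  have "?bad \<subseteq> (\<lambda>(u, v). {u, v}) ` nonquadrangular_arcs (parcs G) rot"
  proof
    fix e assume e: "e \<in> ?bad"
    then obtain u v where uv: "e = {u, v}" "(u, v) \<in> parcs G"
      by (auto simp: uedges_def)
    then have vu: "(v, u) \<in> parcs G"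
      using assms(2) by (auto dest: symD)
    have "\<not> quadrangular_arc rot (u, v) \<or> \<not> quadrangular_arc rot (v, u)"
      using card_quadrangular_faces_on_edge[OF uv(2) vu] e uv(1) by auto
    then show "e \<in> (\<lambda>(u, v). {u, v}) ` nonquadrangular_arcs (parcs G) rot"
      using uv vu by (force simp: nonquadrangular_arcs_def insert_commute)
  qed
  then have "card ?bad \<le> card (nonquadrangular_arcs (parcs G) rot)"
    using assms(1) by (intro surj_card_le) (auto simp: nonquadrangular_arcs_def)
  then show ?thesis
    using assms(3) unfolding near_quadrangular_def by linarith
qed

lemma uedges_eq_image: "uedges G = (\<lambda>(u, v). {u, v}) ` parcs G"
  by (auto simp: uedges_def)

lemma card_parcs_le:
  fixes G :: "'a pair_pre_digraph"
  assumes "finite (parcs G)"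
  shows "card (parcs G) \<le> 2 * card (uedges G)"
proof -
  let ?edge = "\<lambda>(u :: 'a, v). {u, v}"
  have "card {a \<in> parcs G. ?edge a = e} \<le> 2" if e: "e \<in> uedges G" for e
  proof -
    obtain u v where uv: "e = {u, v}"
      using e by (auto simp: uedges_def)
    have "a \<in> {(u, v), (v, u)}" if "?edge a = e" for a
      using that unfolding uv by (cases a) (simp add: doubleton_eq_iff)
    then have "card {a \<in> parcs G. ?edge a = e} \<le> card {(u, v), (v, u)}"
      by (intro card_mono) auto
    also have "\<dots> \<le> 2"
      by (intro card_insert_le_m1) simp_all
    finally show ?thesis .
  qed
  moreover have "card (parcs G) = (\<Sum>e\<in>uedges G. card {a \<in> parcs G. ?edge a = e})"
    using sum.image_gen[OF assms, of "\<lambda>_. 1 :: nat" ?edge] by (simp add: uedges_eq_image)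
  ultimately show ?thesis
    using sum_bounded_above[of "uedges G" _ "2 :: nat"] by (simp add: mult.commute)
qed

theorem ex_near_quadrangular_dense:
  fixes d \<delta> :: real
  assumes "0 < d" and "0 < \<delta>"
  shows "\<exists>N. \<forall>G :: 'a pair_pre_digraph. pair_graph G \<longrightarrow> N \<le> card (pverts G) \<longrightarrow>
    d * (card (pverts G))\<^sup>2 \<le> card (uedges G) \<longrightarrow>
    (\<exists>rot. rotation_system G rot \<and> near_quadrangular \<delta> G rot)"
proof -
  obtain N where N: "\<And>(V :: 'a set) E. finite V \<Longrightarrow> N \<le> card V \<Longrightarrow> E \<subseteq> V \<times> V \<Longrightarrow> sym E \<Longrightarrow>
      irrefl E \<Longrightarrow> \<exists>rot. rotation_on E rot \<and>
        card (nonquadrangular_arcs E rot) \<le> \<delta> * d * (card V)\<^sup>2 + \<delta> / 2 * card E"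
    using ex_rotation_on_dense[of "\<delta> * d" "\<delta> / 2"] assms
    by (metis half_gt_zero mult_pos_pos)
  show ?thesis
  proof (intro exI[of _ N] allI impI)
    fix G :: "'a pair_pre_digraph"
    assume "pair_graph G" and large: "N \<le> card (pverts G)"
      and dense: "d * (card (pverts G))\<^sup>2 \<le> card (uedges G)"
    then interpret pair_graph G
      by simp
    have arcs: "parcs G \<subseteq> pverts G \<times> pverts G"
      using in_arcsD1 in_arcsD2 by auto
    have sym: "sym (parcs G)"
      using arcs_symmetric by (auto intro: symI)
    have irrefl: "irrefl (parcs G)"
      using no_loops' by (auto simp: irrefl_def)
    obtain rot where rot: "rotation_on (parcs G) rot"
        "card (nonquadrangular_arcs (parcs G) rot)
          \<le> \<delta> * d * (card (pverts G))\<^sup>2 + \<delta> / 2 * card (parcs G)"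
      using N[OF _ large arcs sym irrefl] by auto
    note rot(2)
    also have "\<delta> * d * (card (pverts G))\<^sup>2 \<le> \<delta> * card (uedges G)"
      using dense assms(2) by (simp add: mult.assoc)
    also have "\<delta> / 2 * card (parcs G) \<le> \<delta> / 2 * (2 * card (uedges G))"
      using card_parcs_le[of G] assms(2) by (intro mult_left_mono) auto
    finally have "near_quadrangular \<delta> G rot"
      using sym by (intro near_quadrangularI) auto
    moreover have "rotation_system G rot"
      using rot(1)
      by (auto simp: rotation_system_def rotation_on_def neighbours_def Image_singleton)
    ultimately show "\<exists>rot. rotation_system G rot \<and> near_quadrangular \<delta> G rot"
      by blast
  qed
qed

section \<open>Density of quasirandom bipartite graphs\<close>

lemma cut_weight_diff_le_cut_dist:
  assumes "finite V" and "U \<subseteq> V" and "W \<subseteq> V"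
  shows "\<bar>cut_weight w U W - cut_weight w' U W\<bar> \<le> cut_dist V w w' * (card V)\<^sup>2"
proof (cases "V = {}")
  case True
  then show ?thesis
    using assms by (simp add: cut_weight_def)
next
  case False
  let ?diffs = "{\<bar>cut_weight w U W - cut_weight w' U W\<bar> | U W. U \<subseteq> V \<and> W \<subseteq> V}"
  have "?diffs = (\<lambda>(U, W). \<bar>cut_weight w U W - cut_weight w' U W\<bar>) ` (Pow V \<times> Pow V)"
    by auto
  then have "finite ?diffs"
    using assms(1) by simp
  then have "\<bar>cut_weight w U W - cut_weight w' U W\<bar> \<le> Max ?diffs"
    using assms(2,3) by (intro Max_ge) auto
  then show ?thesis
    using False assms(1) by (simp add: cut_dist_def)
qed

lemma cut_weight_graph_weight_le:
  assumes "finite (uedges G)"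
  shows "cut_weight (graph_weight G) U W \<le> card (uedges G)"
proof -
  let ?C = "{{u, v} | u v. u \<in> U \<and> v \<in> W \<and> u \<noteq> v}"
  have "cut_weight (graph_weight G) U W \<le> card (?C \<inter> uedges G)"
    by (cases "finite ?C") (simp_all add: cut_weight_def graph_weight_def sum.If_cases)
  also have "\<dots> \<le> card (uedges G)"
    using assms by (simp add: card_mono)
  finally show ?thesis by simp
qed

lemma cut_weight_complete_bipartite_weight:
  assumes "V\<^sub>1 \<inter> V\<^sub>2 = {}"
  shows "cut_weight (complete_bipartite_weight V\<^sub>1 V\<^sub>2 p) V\<^sub>1 V\<^sub>2 = p * card V\<^sub>1 * card V\<^sub>2"
proof -
  let ?C = "{{u, v} | u v. u \<in> V\<^sub>1 \<and> v \<in> V\<^sub>2 \<and> u \<noteq> v}"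
  have "?C = (\<lambda>(u, v). {u, v}) ` (V\<^sub>1 \<times> V\<^sub>2)"
    using assms by (fastforce simp: image_def)
  moreover have "inj_on (\<lambda>(u, v). {u, v}) (V\<^sub>1 \<times> V\<^sub>2)"
    using assms by (auto simp: inj_on_def doubleton_eq_iff)
  ultimately have "card ?C = card V\<^sub>1 * card V\<^sub>2"
    by (simp add: card_image card_cartesian_product)
  moreover have "cut_weight (complete_bipartite_weight V\<^sub>1 V\<^sub>2 p) V\<^sub>1 V\<^sub>2 = (\<Sum>e\<in>?C. p)"
    unfolding cut_weight_def by (rule sum.cong) (auto simp: complete_bipartite_weight_def)
  ultimately show ?thesis
    by simp
qed

lemma quasirandom_bipartite_density:
  assumes "G \<in> quasirandom_bipartite n p \<epsilon>"
  shows "card (pverts G) = 2 * n" and "(p / 4 - \<epsilon>) * (card (pverts G))\<^sup>2 \<le> card (uedges G)"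
proof -
  obtain V\<^sub>1 V\<^sub>2 where G: "pair_graph G"
    and V: "V\<^sub>1 \<inter> V\<^sub>2 = {}" "V\<^sub>1 \<union> V\<^sub>2 = pverts G" "card V\<^sub>1 = n" "card V\<^sub>2 = n"
    and dist: "cut_dist (pverts G) (graph_weight G) (complete_bipartite_weight V\<^sub>1 V\<^sub>2 p) < \<epsilon>"
    using assms by (auto simp: quasirandom_bipartite_def)
  interpret pair_graph G
    by (rule G)
  have subsets: "V\<^sub>1 \<subseteq> pverts G" "V\<^sub>2 \<subseteq> pverts G"
    using V(2) by auto
  then have "finite V\<^sub>1" "finite V\<^sub>2"
    by (auto intro: finite_subset)
  then show cardV: "card (pverts G) = 2 * n"
    using card_Un_disjoint V by fastforce
  let ?w = "graph_weight G" and ?k = "complete_bipartite_weight V\<^sub>1 V\<^sub>2 p"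
  have "cut_weight ?k V\<^sub>1 V\<^sub>2 - cut_weight ?w V\<^sub>1 V\<^sub>2
      \<le> cut_dist (pverts G) ?w ?k * (card (pverts G))\<^sup>2"
    using cut_weight_diff_le_cut_dist[OF pair_finite_verts subsets, of ?w ?k] by linarith
  also have "\<dots> \<le> \<epsilon> * (card (pverts G))\<^sup>2"
    using dist by (intro mult_right_mono) auto
  finally have "p / 4 * (card (pverts G))\<^sup>2 - cut_weight ?w V\<^sub>1 V\<^sub>2 \<le> \<epsilon> * (card (pverts G))\<^sup>2"
    using V by (simp add: cut_weight_complete_bipartite_weight cardV power2_eq_square)
  moreover have "cut_weight ?w V\<^sub>1 V\<^sub>2 \<le> card (uedges G)"
    by (intro cut_weight_graph_weight_le) (simp add: uedges_eq_image)
  ultimately show "(p / 4 - \<epsilon>) * (card (pverts G))\<^sup>2 \<le> card (uedges G)"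
    by (simp add: left_diff_distrib)
qed

theorem theorem3p9:
  fixes p \<epsilon> :: real
  assumes "0 < p" and "p \<le> 1" and "0 < \<epsilon>" and "\<epsilon> < (p / 4) ^ 16"
  shows "\<exists>n0::nat. \<forall>n\<ge>n0. \<forall>G \<in> (quasirandom_bipartite n p \<epsilon> :: 'a pair_pre_digraph set).
           \<exists>rot. rotation_system G rot \<and> near_quadrangular (10 * \<epsilon>) G rot"
proof -
  have "(p / 4) ^ 16 \<le> (p / 4) ^ 1"
    using assms by (intro power_decreasing) auto
  then have "0 < p / 4 - \<epsilon>"
    using assms(4) by simp
  then obtain N where N: "\<And>G :: 'a pair_pre_digraph. pair_graph G \<Longrightarrow> N \<le> card (pverts G) \<Longrightarrow>
      (p / 4 - \<epsilon>) * (card (pverts G))\<^sup>2 \<le> card (uedges G) \<Longrightarrow>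
      \<exists>rot. rotation_system G rot \<and> near_quadrangular (10 * \<epsilon>) G rot"
    using ex_near_quadrangular_dense[of "p / 4 - \<epsilon>" "10 * \<epsilon>"] assms(3) by auto
  show ?thesis
  proof (intro exI[of _ N] allI impI ballI)
    fix n and G :: "'a pair_pre_digraph"
    assume "N \<le> n" and G: "G \<in> quasirandom_bipartite n p \<epsilon>"
    then have "pair_graph G" "N \<le> card (pverts G)"
      using quasirandom_bipartite_density(1)[OF G] by (auto simp: quasirandom_bipartite_def)
    then show "\<exists>rot. rotation_system G rot \<and> near_quadrangular (10 * \<epsilon>) G rot"
      using N quasirandom_bipartite_density(2)[OF G] by blast
  qed
qed

end
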